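(* Let $(F, v, \Gamma)$ be a Henselian valued field such that $T = \mathrm{Th}(F; +, \cdot, |)$ is dp-small. Then the value group $\Gamma$ is divisible.
   Context: Here $v: F^\times\to\Gamma$ is the valuation and $a\mid b$ holds iff $v(a)\le v(b)$. For a complete theory $T$ in language $L$ with monster model $\mathcal{U}$ ($\mathcal{U}_y$ the $|y|$-tuples from $\mathcal{U}$): a partial type $\pi(x)$ is dp-small if there do not exist $L(\mathcal{U})$-formulas $\varphi_i(x)$ ($i<\omega$), an $L$-formula $\psi(x;y)$ and $b_j\in\mathcal{U}_y$ ($j<\omega$) such that for all $i_0,j_0<\omega$ the type $\pi(x)\cup\{\varphi_{i_0}(x),\psi(x;b_{j_0})\}\cup\{\neg\varphi_i(x): i\ne i_0\}\cup\{\neg\psi(x;b_j): j\neq j_0\}$ is consistent. $T$ is dp-small if $x=x$ is dp-small for $x$ a single variable. *)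

theory Defs
  imports "HOL-Computational_Algebra.Polynomial"
begin

text \<open>A valuation v : F^x -> Gamma onto a linearly ordered abelian group Gamma
  (Gamma is the whole type 'g; the value of 0 is irrelevant, 0 is treated as infinity).\<close>
definition valuation :: "('a::field \<Rightarrow> 'g::linordered_ab_group_add) \<Rightarrow> bool" where
  "valuation v \<longleftrightarrow>
     (\<forall>x y. x \<noteq> 0 \<longrightarrow> y \<noteq> 0 \<longrightarrow> v (x * y) = v x + v y) \<and>
     (\<forall>x y. x \<noteq> 0 \<longrightarrow> y \<noteq> 0 \<longrightarrow> x + y \<noteq> 0 \<longrightarrow> min (v x) (v y) \<le> v (x + y)) \<and>
     (\<forall>g. \<exists>x. x \<noteq> 0 \<and> v x = g)"

definition valring :: "('a::field \<Rightarrow> 'g::linordered_ab_group_add) \<Rightarrow> 'a set" where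
  "valring v = {x. x = 0 \<or> 0 \<le> v x}"

definition maxideal :: "('a::field \<Rightarrow> 'g::linordered_ab_group_add) \<Rightarrow> 'a set" where
  "maxideal v = {x. x = 0 \<or> 0 < v x}"

definition henselian :: "('a::field \<Rightarrow> 'g::linordered_ab_group_add) \<Rightarrow> bool" where
  "henselian v \<longleftrightarrow>
     (\<forall>f a. (\<forall>i. coeff f i \<in> valring v) \<longrightarrow> a \<in> valring v \<longrightarrow>
        poly f a \<in> maxideal v \<longrightarrow>
        poly (pderiv f) a \<noteq> 0 \<longrightarrow> v (poly (pderiv f) a) = 0 \<longrightarrow>
        (\<exists>b \<in> valring v. poly f b = 0 \<and> b - a \<in> maxideal v))"

datatype tm = Var nat | Plus tm tm | Times tm tm

datatype fm = Eq tm tm | Dv tm tm | Neg fm | Conj fm fm | Ex nat fm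

record 'm str =
  univ :: "'m set"
  plusf :: "'m \<Rightarrow> 'm \<Rightarrow> 'm"
  timesf :: "'m \<Rightarrow> 'm \<Rightarrow> 'm"
  dvdr :: "'m \<Rightarrow> 'm \<Rightarrow> bool"

fun tval :: "('m, 'z) str_scheme \<Rightarrow> (nat \<Rightarrow> 'm) \<Rightarrow> tm \<Rightarrow> 'm" where
  "tval S e (Var n) = e n"
| "tval S e (Plus s t) = plusf S (tval S e s) (tval S e t)"
| "tval S e (Times s t) = timesf S (tval S e s) (tval S e t)"

fun sat :: "('m, 'z) str_scheme \<Rightarrow> (nat \<Rightarrow> 'm) \<Rightarrow> fm \<Rightarrow> bool" where
  "sat S e (Eq s t) = (tval S e s = tval S e t)"
| "sat S e (Dv s t) = dvdr S (tval S e s) (tval S e t)"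
| "sat S e (Neg \<phi>) = (\<not> sat S e \<phi>)"
| "sat S e (Conj \<phi> \<psi>) = (sat S e \<phi> \<and> sat S e \<psi>)"
| "sat S e (Ex n \<phi>) = (\<exists>a \<in> univ S. sat S (e(n := a)) \<phi>)"

fun fv_tm :: "tm \<Rightarrow> nat set" where
  "fv_tm (Var n) = {n}"
| "fv_tm (Plus s t) = fv_tm s \<union> fv_tm t"
| "fv_tm (Times s t) = fv_tm s \<union> fv_tm t"

fun fv :: "fm \<Rightarrow> nat set" where
  "fv (Eq s t) = fv_tm s \<union> fv_tm t"
| "fv (Dv s t) = fv_tm s \<union> fv_tm t"
| "fv (Neg \<phi>) = fv \<phi>"
| "fv (Conj \<phi> \<psi>) = fv \<phi> \<union> fv \<psi>"
| "fv (Ex n \<phi>) = fv \<phi> - {n}"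

definition is_structure :: "('m, 'z) str_scheme \<Rightarrow> bool" where
  "is_structure S \<longleftrightarrow> univ S \<noteq> {} \<and>
     (\<forall>a \<in> univ S. \<forall>b \<in> univ S. plusf S a b \<in> univ S \<and> timesf S a b \<in> univ S)"

definition holds :: "('m, 'z) str_scheme \<Rightarrow> fm \<Rightarrow> bool" where
  "holds S \<phi> \<longleftrightarrow> (\<forall>e. range e \<subseteq> univ S \<longrightarrow> sat S e \<phi>)"

definition elem_equiv :: "('m, 'z) str_scheme \<Rightarrow> ('n, 'w) str_scheme \<Rightarrow> bool" where
  "elem_equiv M N \<longleftrightarrow> (\<forall>\<phi>. fv \<phi> = {} \<longrightarrow> (holds M \<phi> \<longleftrightarrow> holds N \<phi>))"

definition VF :: "('a::field \<Rightarrow> 'g::linordered_ab_group_add) \<Rightarrow> 'a str" where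
  "VF v = \<lparr> univ = UNIV, plusf = (+), timesf = (*),
            dvdr = (\<lambda>a b. b = 0 \<or> (a \<noteq> 0 \<and> v a \<le> v b)) \<rparr>"

text \<open>An ict-pattern of depth 2 for the single variable x (= variable 0), realised
  as finite satisfiability in a model M of Th(S). Formulas with parameters
  phi_i(x) are pairs (phi i, p i) of a formula and an assignment of the
  parameter variables; psi(x;y) is a parameter-free formula and b j assigns y.
  Witnessed in a countable model (carrier a set of naturals), which by
  downward Loewenheim-Skolem and universality of the monster model is
  equivalent to a pattern in the monster model.\<close>
definition has_dp_pattern :: "('m, 'z) str_scheme \<Rightarrow> bool" where
  "has_dp_pattern M \<longleftrightarrow>
     (\<exists>(\<phi> :: nat \<Rightarrow> fm) (p :: nat \<Rightarrow> nat \<Rightarrow> 'm) (\<psi> :: fm) (b :: nat \<Rightarrow> nat \<Rightarrow> 'm).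
        (\<forall>i. range (p i) \<subseteq> univ M) \<and> (\<forall>j. range (b j) \<subseteq> univ M) \<and>
        (\<forall>i0 j0 I J. finite I \<longrightarrow> finite J \<longrightarrow>
           (\<exists>a \<in> univ M.
              sat M ((p i0)(0 := a)) (\<phi> i0) \<and> sat M ((b j0)(0 := a)) \<psi> \<and>
              (\<forall>i \<in> I - {i0}. \<not> sat M ((p i)(0 := a)) (\<phi> i)) \<and>
              (\<forall>j \<in> J - {j0}. \<not> sat M ((b j)(0 := a)) \<psi>))))"

definition dp_small :: "('m, 'z) str_scheme \<Rightarrow> bool" where
  "dp_small S \<longleftrightarrow>
     \<not> (\<exists>M :: nat str. is_structure M \<and> elem_equiv M S \<and> has_dp_pattern M)"

end

theory Submission
  imports Defs "HOL-Library.Countable_Set"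
begin

text \<open>Suppose \<open>\<gamma> > 0\<close> is not divisible by \<open>n\<close> in \<open>\<Gamma>\<close>, and let \<open>v b = \<gamma>\<close>. The annuli
  \<open>n^j \<gamma> \<le> v x < n^(j+1) \<gamma>\<close> form a uniformly definable disjoint family \<open>\<psi>_j\<close>. The sets
  \<open>v x \<in> n^i \<Gamma> - n^(i+1) \<Gamma>\<close> are disjoint for different \<open>i\<close>, and the \<open>i\<close>-th one meets the annulus
  \<open>\<psi>_j\<close> for every \<open>j > i\<close>, in \<open>b^(n^j + n^i)\<close>. Instead of passing to a saturated model, we restrict
  the \<open>i\<close>-th set to \<open>v x \<ge> n^(i+1) \<gamma>\<close> and add to it one new point from each of the finitely many
  annuli \<open>\<psi>_j\<close> with \<open>j \<le> i\<close>. This gives a pattern in \<open>F\<close> itself, and the downward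
  Loewenheim-Skolem theorem moves it to a countable model.\<close>

section \<open>Countable elementary substructures\<close>

instance tm :: countable by countable_datatype
instance fm :: countable by countable_datatype

lemma tval_cong: "(\<And>k. k \<in> fv_tm t \<Longrightarrow> e k = e' k) \<Longrightarrow> tval S e t = tval S e' t"
  by (induction t) auto

lemma sat_cong: "(\<And>k. k \<in> fv \<phi> \<Longrightarrow> e k = e' k) \<Longrightarrow> sat S e \<phi> = sat S e' \<phi>"
proof (induction \<phi> arbitrary: e e')
  case (Eq s t)
  then show ?case using tval_cong[of s e e' S] tval_cong[of t e e' S] by auto
next
  case (Dv s t)
  then show ?case using tval_cong[of s e e' S] tval_cong[of t e e' S] by auto
next
  case (Ex n \<phi>)
  have "sat S (e(n := a)) \<phi> = sat S (e'(n := a)) \<phi>" for a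
    by (rule Ex.IH) (use Ex.prems in auto)
  then show ?case by simp
next
  case (Neg \<phi>)
  have "sat S e \<phi> = sat S e' \<phi>" by (rule Neg.IH) (use Neg.prems in auto)
  then show ?case by simp
next
  case (Conj \<phi> \<psi>)
  have "sat S e \<phi> = sat S e' \<phi>" by (rule Conj.IH(1)) (use Conj.prems in auto)
  moreover have "sat S e \<psi> = sat S e' \<psi>" by (rule Conj.IH(2)) (use Conj.prems in auto)
  ultimately show ?case by simp
qed

lemma finite_fv_tm: "finite (fv_tm t)"
  by (induction t) auto

lemma finite_fv: "finite (fv \<phi>)"
  by (induction \<phi>) (auto simp: finite_fv_tm)

lemma tval_in_univ: "is_structure S \<Longrightarrow> range e \<subseteq> univ S \<Longrightarrow> tval S e t \<in> univ S"
  by (induction t) (auto simp: is_structure_def)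

lemma holds_sentence_iff:
  assumes "fv \<phi> = {}" "range e \<subseteq> univ S"
  shows "holds S \<phi> \<longleftrightarrow> sat S e \<phi>"
proof -
  have "sat S e' \<phi> = sat S e \<phi>" for e'
    by (rule sat_cong) (use assms in auto)
  then show ?thesis using assms unfolding holds_def by auto
qed

section \<open>Skolem hulls and the downward Loewenheim-Skolem theorem\<close>

datatype skolem_term = Const nat | Skolem fm nat "skolem_term list"

instance skolem_term :: countable by countable_datatype

text \<open>A formula has finitely many free variables, so a finite list of values decides it; the
  other variables get the default \<open>d\<close>.\<close>

definition list_env :: "'m \<Rightarrow> 'm list \<Rightarrow> nat \<Rightarrow> 'm" where
  "list_env d l k = (if k < length l then l ! k else d)"

text \<open>The hull is the range of this map on a countable datatype, so its countability is
  immediate. The fallback \<open>c 0\<close> keeps every value in the universe.\<close>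

fun skolem_val :: "('m, 'z) str_scheme \<Rightarrow> (nat \<Rightarrow> 'm) \<Rightarrow> skolem_term \<Rightarrow> 'm" where
  "skolem_val S c (Const k) = c k"
| "skolem_val S c (Skolem \<phi> n ts) =
     (let e = list_env (c 0) (map (skolem_val S c) ts)
      in if \<exists>a \<in> univ S. sat S (e(n := a)) \<phi> then SOME a. a \<in> univ S \<and> sat S (e(n := a)) \<phi> else c 0)"

lemma skolem_val_in_univ:
  assumes "range c \<subseteq> univ S"
  shows "skolem_val S c t \<in> univ S"
proof (cases t)
  case (Const k)
  then show ?thesis using assms by auto
next
  case (Skolem \<phi> n ts)
  define e where "e = list_env (c 0) (map (skolem_val S c) ts)"
  have "(SOME a. a \<in> univ S \<and> sat S (e(n := a)) \<phi>) \<in> univ S" if "\<exists>a \<in> univ S. sat S (e(n := a)) \<phi>"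
    using someI_ex[of "\<lambda>a. a \<in> univ S \<and> sat S (e(n := a)) \<phi>"] that by blast
  then show ?thesis using assms Skolem by (auto simp: Let_def e_def[symmetric])
qed

text \<open>The Tarski-Vaught test for the hull: name each \<open>e k\<close> by a term and apply
  \<open>Skolem\<close> to the terms for all variables below a bound of \<open>fv \<phi>\<close>;
  the value of the result is a witness.\<close>

lemma skolem_val_witness:
  assumes e: "range e \<subseteq> range (skolem_val S c)"
    and a: "a \<in> univ S" "sat S (e(n := a)) \<phi>"
  shows "\<exists>a' \<in> range (skolem_val S c). a' \<in> univ S \<and> sat S (e(n := a')) \<phi>"
proof -
  define s where "s k = (SOME t. skolem_val S c t = e k)" for k
  have s: "skolem_val S c (s k) = e k" for k
  proof -
    have "e k \<in> range (skolem_val S c)" using e by blast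
    then have "\<exists>t. skolem_val S c t = e k" by (metis rangeE)
    then show ?thesis unfolding s_def by (rule someI_ex)
  qed
  obtain m where m: "\<And>k. k \<in> fv \<phi> \<Longrightarrow> k < m"
    using finite_fv[of \<phi>] by (meson finite_nat_set_iff_bounded)
  define ts where "ts = map s [0..<m]"
  define e' where "e' = list_env (c 0) (map (skolem_val S c) ts)"
  have cong: "sat S (e'(n := x)) \<phi> = sat S (e(n := x)) \<phi>" for x
    by (rule sat_cong) (use m in \<open>auto simp: e'_def list_env_def ts_def s\<close>)
  let ?a = "SOME x. x \<in> univ S \<and> sat S (e'(n := x)) \<phi>"
  have ex: "\<exists>x \<in> univ S. sat S (e'(n := x)) \<phi>" using a cong by blast
  then have "?a \<in> univ S \<and> sat S (e'(n := ?a)) \<phi>"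
    using someI_ex[of "\<lambda>x. x \<in> univ S \<and> sat S (e'(n := x)) \<phi>"] by blast
  moreover have "skolem_val S c (Skolem \<phi> n ts) = ?a"
    using ex by (simp add: e'_def[symmetric] Let_def)
  ultimately show ?thesis using cong by (metis rangeI)
qed

text \<open>An instance of the witness property: the sum is the only value of \<open>Var 2\<close>
  that satisfies \<open>Eq (Var 2) (Plus (Var 0) (Var 1))\<close>, and likewise for the
  product.\<close>

lemma skolem_val_closed:
  assumes S: "is_structure S" and c: "range c \<subseteq> univ S"
    and xy: "x \<in> range (skolem_val S c)" "y \<in> range (skolem_val S c)"
  shows "plusf S x y \<in> range (skolem_val S c)" "timesf S x y \<in> range (skolem_val S c)"
proof -
  define e where "e = (\<lambda>k::nat. if k = 0 then x else y)"
  have e: "range e \<subseteq> range (skolem_val S c)" using xy by (auto simp: e_def)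
  have "x \<in> univ S" "y \<in> univ S" using xy skolem_val_in_univ[OF c] by auto
  then have cl: "plusf S x y \<in> univ S" "timesf S x y \<in> univ S" using S by (auto simp: is_structure_def)
  show "plusf S x y \<in> range (skolem_val S c)"
    using skolem_val_witness[OF e cl(1), of 2 "Eq (Var 2) (Plus (Var 0) (Var 1))"]
    by (auto simp: e_def) (metis rangeI)
  show "timesf S x y \<in> range (skolem_val S c)"
    using skolem_val_witness[OF e cl(2), of 2 "Eq (Var 2) (Times (Var 0) (Var 1))"]
    by (auto simp: e_def) (metis rangeI)
qed

lemma countable_elementary_substructure:
  fixes S :: "'m str"
  assumes S: "is_structure S" and A: "countable A" "A \<subseteq> univ S"
  obtains N where "countable N" "A \<subseteq> N" "N \<subseteq> univ S" "is_structure (S\<lparr>univ := N\<rparr>)"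
    "\<And>e \<phi>. range e \<subseteq> N \<Longrightarrow> sat (S\<lparr>univ := N\<rparr>) e \<phi> = sat S e \<phi>"
proof -
  obtain d where d: "d \<in> univ S" using S by (auto simp: is_structure_def)
  \<comment> \<open>Inserting \<open>d\<close> keeps the enumerated set nonempty even if
    \<open>A\<close> is empty.\<close>
  define c where "c = from_nat_into (insert d A)"
  have c: "range c = insert d A" unfolding c_def using A by (intro range_from_nat_into) auto
  then have c': "range c \<subseteq> univ S" using d A by auto
  define N where "N = range (skolem_val S c)"
  have N: "N \<subseteq> univ S" unfolding N_def using skolem_val_in_univ[OF c'] by auto
  have "range c \<subseteq> N" unfolding N_def
    by (metis image_subsetI rangeI skolem_val.simps(1))
  then have AN: "A \<subseteq> N" using c by auto
  have tv: "tval (S\<lparr>univ := N\<rparr>) e t = tval S e t" for e t by (induction t) auto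
  have "sat (S\<lparr>univ := N\<rparr>) e \<phi> = sat S e \<phi>" if "range e \<subseteq> N" for e \<phi>
    using that
  proof (induction \<phi> arbitrary: e)
    case (Ex n \<phi>)
    have "sat (S\<lparr>univ := N\<rparr>) (e(n := a)) \<phi> = sat S (e(n := a)) \<phi>" if "a \<in> N" for a
      by (rule Ex.IH) (use Ex.prems that in auto)
    moreover have "(\<exists>a \<in> univ S. sat S (e(n := a)) \<phi>) = (\<exists>a \<in> N. sat S (e(n := a)) \<phi>)"
      using skolem_val_witness[of e S c _ n \<phi>] Ex.prems N unfolding N_def by blast
    ultimately show ?case by auto
  qed (auto simp: tv)
  moreover have "is_structure (S\<lparr>univ := N\<rparr>)"
    using skolem_val_closed[OF S c'] by (auto simp: is_structure_def N_def)
  ultimately show thesis using that[of N] AN N by (auto simp: N_def)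
qed

section \<open>Transport of structure to a carrier of natural numbers\<close>

definition transport :: "('m \<Rightarrow> 'n) \<Rightarrow> 'm str \<Rightarrow> 'n str" where
  "transport f S = (let g = inv_into (univ S) f in
     \<lparr>univ = f ` univ S, plusf = (\<lambda>x y. f (plusf S (g x) (g y))),
      timesf = (\<lambda>x y. f (timesf S (g x) (g y))), dvdr = (\<lambda>x y. dvdr S (g x) (g y))\<rparr>)"

lemma transport_simps:
  assumes "inj_on f (univ S)"
  shows "univ (transport f S) = f ` univ S"
    and "x \<in> univ S \<Longrightarrow> y \<in> univ S \<Longrightarrow> plusf (transport f S) (f x) (f y) = f (plusf S x y)"
    and "x \<in> univ S \<Longrightarrow> y \<in> univ S \<Longrightarrow> timesf (transport f S) (f x) (f y) = f (timesf S x y)"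
    and "x \<in> univ S \<Longrightarrow> y \<in> univ S \<Longrightarrow> dvdr (transport f S) (f x) (f y) = dvdr S x y"
  using assms by (simp_all add: transport_def Let_def)

lemma is_structure_transport:
  assumes "is_structure S" "inj_on f (univ S)"
  shows "is_structure (transport f S)"
  using assms by (auto simp: is_structure_def transport_simps)

lemma tval_transport:
  assumes "is_structure S" "inj_on f (univ S)" "range e \<subseteq> univ S"
  shows "tval (transport f S) (f \<circ> e) t = f (tval S e t)"
  by (induction t) (use assms in \<open>simp_all add: transport_simps tval_in_univ\<close>)

lemma sat_transport:
  assumes S: "is_structure S" and f: "inj_on f (univ S)" and "range e \<subseteq> univ S"
  shows "sat (transport f S) (f \<circ> e) \<phi> = sat S e \<phi>"
  using assms(3)
proof (induction \<phi> arbitrary: e)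
  case (Eq s t)
  then show ?case
    by (simp only: sat.simps tval_transport[OF S f] tval_in_univ[OF S] inj_on_eq_iff[OF f])
next
  case (Dv s t)
  then show ?case
    by (simp only: sat.simps tval_transport[OF S f] tval_in_univ[OF S] transport_simps(4)[OF f])
next
  case (Ex n \<phi>)
  have "sat (transport f S) ((f \<circ> e)(n := f a)) \<phi> = sat S (e(n := a)) \<phi>" if "a \<in> univ S" for a
  proof -
    have "(f \<circ> e)(n := f a) = f \<circ> e(n := a)" by auto
    moreover have "range (e(n := a)) \<subseteq> univ S" using Ex.prems that by auto
    ultimately show ?thesis using Ex.IH by metis
  qed
  then show ?case unfolding sat.simps transport_simps(1)[OF f] by blast
qed auto

text \<open>\<open>dp_small\<close> speaks of models on the naturals, so a countable elementary
  substructure is numbered by \<open>f\<close>. Truth is kept for all assignments into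
  \<open>A\<close>, not just for sentences, so that a pattern can be moved along
  \<open>f\<close>.\<close>

lemma countable_elementary_model:
  fixes S :: "'m str"
  assumes S: "is_structure S" and A: "countable A" "A \<subseteq> univ S"
  obtains M :: "nat str" and f :: "'m \<Rightarrow> nat"
  where "is_structure M" "elem_equiv M S" "f ` A \<subseteq> univ M"
    "\<And>e \<phi>. range e \<subseteq> A \<Longrightarrow> sat M (f \<circ> e) \<phi> = sat S e \<phi>"
proof -
  obtain N where N: "countable N" "A \<subseteq> N" "N \<subseteq> univ S" "is_structure (S\<lparr>univ := N\<rparr>)"
    "\<And>e \<phi>. range e \<subseteq> N \<Longrightarrow> sat (S\<lparr>univ := N\<rparr>) e \<phi> = sat S e \<phi>"
    by (rule countable_elementary_substructure[OF S A]) blast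
  define f where "f = to_nat_on N"
  have f: "inj_on f (univ (S\<lparr>univ := N\<rparr>))" using N(1) inj_on_to_nat_on[of N] by (simp add: f_def)
  define M where "M = transport f (S\<lparr>univ := N\<rparr>)"
  have sat: "sat M (f \<circ> e) \<phi> = sat S e \<phi>" if "range e \<subseteq> N" for e \<phi>
    unfolding M_def using sat_transport[OF N(4) f] N(5) that by simp
  have univ_M: "univ M = f ` N" using transport_simps(1)[OF f] by (simp add: M_def)
  obtain d where d: "d \<in> N" using N(4) by (auto simp: is_structure_def)
  have "elem_equiv M S"
    unfolding elem_equiv_def
  proof (intro allI impI)
    fix \<phi> assume \<phi>: "fv \<phi> = {}"
    have "holds M \<phi> = sat M (f \<circ> (\<lambda>_. d)) \<phi>"
      by (rule holds_sentence_iff[OF \<phi>]) (use d univ_M in auto)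
    moreover have "holds S \<phi> = sat S (\<lambda>_. d) \<phi>"
      by (rule holds_sentence_iff[OF \<phi>]) (use d N in auto)
    ultimately show "holds M \<phi> = holds S \<phi>" using sat d by auto
  qed
  then show thesis
    using that[of M f] is_structure_transport[OF N(4) f] sat N(2) univ_M unfolding M_def by blast
qed

text \<open>A pattern involves countably many elements: its parameters and one chosen realisation
  for each \<open>i0\<close>, \<open>j0\<close> and finite \<open>I\<close>, \<open>J\<close>. All
  of them are put into \<open>A\<close> and carried to the countable model.\<close>

lemma has_dp_pattern_imp_not_dp_small:
  fixes S :: "'m str"
  assumes S: "is_structure S" and pat: "has_dp_pattern S"
  shows "\<not> dp_small S"
proof -
  obtain \<phi> :: "nat \<Rightarrow> fm" and p \<psi> b where pat':
    "(\<forall>i :: nat. range (p i) \<subseteq> univ S) \<and> (\<forall>j :: nat. range (b j) \<subseteq> univ S) \<and>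
     (\<forall>i0 j0 I J. finite I \<longrightarrow> finite J \<longrightarrow>
        (\<exists>a \<in> univ S.
           sat S ((p i0)(0 := a)) (\<phi> i0) \<and> sat S ((b j0)(0 := a)) \<psi> \<and>
           (\<forall>i \<in> I - {i0}. \<not> sat S ((p i)(0 := a)) (\<phi> i)) \<and>
           (\<forall>j \<in> J - {j0}. \<not> sat S ((b j)(0 := a)) \<psi>)))"
    using pat unfolding has_dp_pattern_def by (elim exE) (rule that)
  then have p: "\<And>i. range (p i) \<subseteq> univ S" and b: "\<And>j. range (b j) \<subseteq> univ S"
    by simp_all
  define Q where "Q i0 j0 I J a \<longleftrightarrow>
      sat S ((p i0)(0 := a)) (\<phi> i0) \<and> sat S ((b j0)(0 := a)) \<psi> \<and>
      (\<forall>i \<in> I - {i0}. \<not> sat S ((p i)(0 := a)) (\<phi> i)) \<and>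
      (\<forall>j \<in> J - {j0}. \<not> sat S ((b j)(0 := a)) \<psi>)" for i0 j0 I J a
  define w where "w i0 j0 I J = (SOME a. a \<in> univ S \<and> Q i0 j0 I J a)" for i0 j0 I J
  have w: "w i0 j0 I J \<in> univ S \<and> Q i0 j0 I J (w i0 j0 I J)" if "finite I" "finite J" for i0 j0 I J
  proof -
    have "\<exists>a \<in> univ S. Q i0 j0 I J a"
      unfolding Q_def by (rule conjunct2[OF conjunct2[OF pat'], rule_format, OF that])
    then have "\<exists>a. a \<in> univ S \<and> Q i0 j0 I J a" by (rule bexE) (rule exI, rule conjI)
    then show ?thesis unfolding w_def by (rule someI_ex)
  qed
  let ?F = "{I :: nat set. finite I}"
  define W where "W = (\<lambda>(i, j, I, J). w i j I J) ` (UNIV \<times> UNIV \<times> ?F \<times> ?F)"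
  have W: "w i j I J \<in> W" if "finite I" "finite J" for i j I J
    unfolding W_def by (rule image_eqI[of _ _ "(i, j, I, J)"]) (use that in simp_all)
  define A where "A = (\<Union>i. range (p i)) \<union> (\<Union>j. range (b j)) \<union> W"
  have "countable ?F" using countable_Collect_finite[where 'a = nat] by simp
  then have "countable W" unfolding W_def by (intro countable_image countable_SIGMA) simp_all
  then have A: "countable A" unfolding A_def by simp
  have "W \<subseteq> univ S" unfolding W_def using w by auto
  then have A': "A \<subseteq> univ S" unfolding A_def using p b by simp blast
  obtain M :: "nat str" and f where
    M: "is_structure M" "elem_equiv M S" "f ` A \<subseteq> univ M" and
    sat: "\<And>e \<phi>. range e \<subseteq> A \<Longrightarrow> sat M (f \<circ> e) \<phi> = sat S e \<phi>"
    by (rule countable_elementary_model[OF S A A']) (rule that)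
  have upd: "sat M ((f \<circ> e)(0 := f a)) \<chi> = sat S (e(0 := a)) \<chi>" if "range e \<subseteq> A" "a \<in> A" for e a \<chi>
  proof -
    have "(f \<circ> e)(0 := f a) = f \<circ> e(0 := a)" by auto
    then show ?thesis using sat[of "e(0 := a)"] that by (simp add: image_subset_iff)
  qed
  have pA: "range (p i) \<subseteq> A" and bA: "range (b i) \<subseteq> A" for i by (auto simp: A_def)
  have "has_dp_pattern M"
    unfolding has_dp_pattern_def
  proof (intro exI conjI allI impI)
    fix i show "range (f \<circ> p i) \<subseteq> univ M" using pA[of i] M(3) by auto
  next
    fix j show "range (f \<circ> b j) \<subseteq> univ M" using bA[of j] M(3) by auto
  next
    fix i0 j0 and I J :: "nat set" assume IJ: "finite I" "finite J"
    have wA: "w i0 j0 I J \<in> A" using W[OF IJ] by (auto simp: A_def)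
    show "\<exists>a \<in> univ M.
              sat M ((f \<circ> p i0)(0 := a)) (\<phi> i0) \<and> sat M ((f \<circ> b j0)(0 := a)) \<psi> \<and>
              (\<forall>i \<in> I - {i0}. \<not> sat M ((f \<circ> p i)(0 := a)) (\<phi> i)) \<and>
              (\<forall>j \<in> J - {j0}. \<not> sat M ((f \<circ> b j)(0 := a)) \<psi>)"
      by (rule bexI[of _ "f (w i0 j0 I J)"])
        (use w[OF IJ, of i0 j0] wA M(3) in \<open>simp_all add: Q_def upd[OF pA wA] upd[OF bA wA] image_subset_iff\<close>)
  qed
  then show ?thesis using M unfolding dp_small_def by blast
qed

section \<open>Valuations of powers\<close>

locale valued_field =
  fixes v :: "'a::field \<Rightarrow> 'g::linordered_ab_group_add"
  assumes valuation: "valuation v"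
begin

lemma v_mult: "x \<noteq> 0 \<Longrightarrow> y \<noteq> 0 \<Longrightarrow> v (x * y) = v x + v y"
  using valuation by (simp add: valuation_def)

lemma v_add: "x \<noteq> 0 \<Longrightarrow> y \<noteq> 0 \<Longrightarrow> x + y \<noteq> 0 \<Longrightarrow> min (v x) (v y) \<le> v (x + y)"
  using valuation by (simp add: valuation_def)

lemma v_one: "v 1 = 0"
  using v_mult[of 1 1] by simp

lemma v_minus: "x \<noteq> 0 \<Longrightarrow> v (- x) = v x"
proof -
  assume x: "x \<noteq> 0"
  have "v (- 1) + v (- 1) = 0" using v_mult[of "- 1" "- 1"] v_one by simp
  then have "v (- 1) = 0" by (simp add: double_zero)
  then show ?thesis using v_mult[of "- 1" x] x by simp
qed

lemma v_inverse: "x \<noteq> 0 \<Longrightarrow> v (inverse x) = - v x"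
  using v_mult[of x "inverse x"] v_one by (simp add: eq_neg_iff_add_eq_0 add.commute)

lemma v_divide: "x \<noteq> 0 \<Longrightarrow> y \<noteq> 0 \<Longrightarrow> v (x / y) = v x - v y"
  by (simp add: divide_inverse v_mult v_inverse)

lemma v_power: "x \<noteq> 0 \<Longrightarrow> v (x ^ k) = (\<Sum>i<k. v x)"
  by (induction k) (simp_all add: v_one v_mult add.commute)

lemma v_power_pos:
  assumes "x \<noteq> 0" "0 < v x" "0 < k"
  shows "0 < v (x ^ k)"
  using assms by (auto simp: v_power intro!: sum_pos)

lemma v_power_less_iff:
  assumes "x \<noteq> 0" "0 < v x"
  shows "v (x ^ k) < v (x ^ l) \<longleftrightarrow> k < l"
proof -
  have "v (x ^ k) < v (x ^ l)" if "k < l" for k l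
  proof -
    have "v (x ^ l) = v (x ^ k) + v (x ^ (l - k))"
      using that assms(1) v_mult[of "x ^ k" "x ^ (l - k)"] by (simp add: power_add[symmetric])
    then show ?thesis using v_power_pos[OF assms, of "l - k"] that by simp
  qed
  then show ?thesis by (metis less_asym nat_neq_iff order_less_irrefl)
qed

lemma v_power_le_iff: "x \<noteq> 0 \<Longrightarrow> 0 < v x \<Longrightarrow> v (x ^ k) \<le> v (x ^ l) \<longleftrightarrow> k \<le> l"
  using v_power_less_iff[of x l k] by (simp add: not_less[symmetric])

lemma v_power_eq_iff: "x \<noteq> 0 \<Longrightarrow> 0 < v x \<Longrightarrow> v (x ^ k) = v (x ^ l) \<longleftrightarrow> k = l"
  by (metis v_power_less_iff nat_neq_iff order_less_irrefl)

text \<open>An ordered group is torsion-free: the \<open>k\<close>-th powers of \<open>x / y\<close>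
  and \<open>y / x\<close> have value 0, so neither quotient has positive value.\<close>

lemma v_power_cancel:
  assumes "x \<noteq> 0" "y \<noteq> 0" "0 < k" "v (x ^ k) = v (y ^ k)"
  shows "v x = v y"
proof -
  have z: "v ((x / y) ^ k) = 0" "v ((y / x) ^ k) = 0"
    using assms by (simp_all add: power_divide v_divide)
  have "\<not> 0 < v (x / y)" "\<not> 0 < v (y / x)"
    using z v_power_pos[of "x / y" k] v_power_pos[of "y / x" k] assms by auto
  then show ?thesis using assms by (simp add: v_divide not_less)
qed

lemma one_plus_pos:
  assumes "x \<noteq> 0" "0 < v x"
  shows "1 + x \<noteq> 0" "v (1 + x) = 0"
proof -
  show nz: "1 + x \<noteq> 0"
  proof
    assume "1 + x = 0"
    then have "x = - 1" by (simp add: eq_neg_iff_add_eq_0 add.commute)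
    then show False using assms v_minus[of 1] v_one by simp
  qed
  have "0 \<le> v (1 + x)" using v_add[of 1 x] assms nz v_one by simp
  \<comment> \<open>The ultrametric inequality for 1 = (1 + x) - x; as \<open>v x\<close> is
    positive, \<open>v (1 + x)\<close> cannot be.\<close>
  moreover have "min (v (1 + x)) (v x) \<le> 0"
    using v_add[of "1 + x" "- x"] assms nz v_one v_minus by simp
  ultimately show "v (1 + x) = 0" using assms by (auto simp: min_def split: if_splits)
qed

text \<open>Membership of \<open>v x\<close> in the subgroup m \<Gamma>, phrased by a field element
  so that a first-order formula can express it.\<close>

definition val_mult :: "nat \<Rightarrow> 'a \<Rightarrow> bool" where
  "val_mult m x \<longleftrightarrow> (\<exists>u. u \<noteq> 0 \<and> v (u ^ m) = v x)"

lemma val_mult_dvd: "m dvd k \<Longrightarrow> val_mult k x \<Longrightarrow> val_mult m x"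
  unfolding val_mult_def by (metis dvdE mult.commute power_mult power_not_zero)

end

section \<open>The pattern\<close>

fun pow_tm :: "tm \<Rightarrow> nat \<Rightarrow> tm" where
  "pow_tm t (Suc (Suc k)) = Times t (pow_tm t (Suc k))"
| "pow_tm t _ = t"

text \<open>The language has no constant 1, so \<open>pow_tm t 0\<close> is \<open>t\<close> as well
  and the exponent must be positive.\<close>

lemma tval_pow_tm: "0 < k \<Longrightarrow> tval (VF v) e (pow_tm t k) = tval (VF v) e t ^ k"
  by (induction t k rule: pow_tm.induct) (auto simp: VF_def)

definition disj_fm :: "fm \<Rightarrow> fm \<Rightarrow> fm" where
  "disj_fm \<phi> \<psi> = Neg (Conj (Neg \<phi>) (Neg \<psi>))"

lemma sat_disj_fm: "sat S e (disj_fm \<phi> \<psi>) \<longleftrightarrow> sat S e \<phi> \<or> sat S e \<psi>"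
  by (simp add: disj_fm_def)

lemma sat_foldr_disj_fm:
  "sat S e (foldr (\<lambda>j. disj_fm (\<phi> j)) js \<psi>) \<longleftrightarrow> (\<exists>j \<in> set js. sat S e (\<phi> j)) \<or> sat S e \<psi>"
  by (induction js) (auto simp: sat_disj_fm)

definition val_mult_fm :: "nat \<Rightarrow> fm" where
  "val_mult_fm m = Ex 2 (Conj (Dv (pow_tm (Var 2) m) (Var 0)) (Dv (Var 0) (pow_tm (Var 2) m)))"

text \<open>The endpoints are the parameters \<open>Var 1\<close> and \<open>Var 2\<close>, so that
  a single formula serves every annulus. For nonzero \<open>Var 0\<close> the negated divisibility
  is the strict upper bound.\<close>

definition annulus_fm :: fm where
  "annulus_fm = Conj (Dv (Var 1) (Var 0)) (Neg (Dv (Var 2) (Var 0)))"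

section \<open>The classes, the annuli and the points that realise the pattern\<close>

locale indivisible = valued_field v
  for v :: "'a::field \<Rightarrow> 'g::linordered_ab_group_add" +
  fixes b :: 'a and n :: nat
  assumes b: "b \<noteq> 0" "0 < v b" and n: "2 \<le> n"
    and indivisible: "\<And>u. u \<noteq> 0 \<Longrightarrow> v (u ^ n) \<noteq> v b"
begin

lemma n_pow_pos: "0 < n ^ k"
  using n by simp

lemma n_pow_le_iff: "n ^ k \<le> n ^ l \<longleftrightarrow> k \<le> l"
  using n by simp

lemma n_pow_less_iff: "n ^ k < n ^ l \<longleftrightarrow> k < l"
  using n by simp

text \<open>The exponent is n^i (n l + 1) with l = n^(j-i-1). If n^(i+1) divided the value,
  cancelling n^i would put (n l + 1) \<gamma>, and hence \<gamma>, into n \<Gamma>.\<close>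

lemma val_mult_sum_powers:
  assumes "i < j" "v x = v (b ^ (n ^ j + n ^ i))"
  shows "val_mult (n ^ k) x \<longleftrightarrow> k \<le> i"
proof
  assume "k \<le> i"
  have "n ^ k dvd n ^ j + n ^ i" using assms \<open>k \<le> i\<close> by (intro dvd_add le_imp_power_dvd) auto
  then obtain l where "n ^ j + n ^ i = n ^ k * l" by auto
  then have "v ((b ^ l) ^ (n ^ k)) = v x" using assms(2) by (simp add: power_mult[symmetric] mult.commute)
  then show "val_mult (n ^ k) x" unfolding val_mult_def using b by (intro exI[of _ "b ^ l"]) auto
next
  assume *: "val_mult (n ^ k) x"
  show "k \<le> i"
  proof (rule ccontr)
    assume "\<not> k \<le> i"
    then have "n ^ Suc i dvd n ^ k" by (intro le_imp_power_dvd) auto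
    with * obtain u where u: "u \<noteq> 0" "v (u ^ (n ^ Suc i)) = v x"
      using val_mult_dvd unfolding val_mult_def by blast
    define l where "l = n ^ (j - Suc i)"
    have e: "n ^ j = n ^ Suc i * l"
      unfolding l_def using assms(1) by (subst power_add[symmetric]) auto
    have "(u ^ n) ^ (n ^ i) = u ^ (n ^ Suc i)" by (simp add: power_mult[symmetric])
    moreover have "(b ^ (n * l + 1)) ^ (n ^ i) = b ^ (n ^ j + n ^ i)"
      unfolding e by (subst power_mult[symmetric]) (simp add: algebra_simps)
    ultimately have "v ((u ^ n) ^ (n ^ i)) = v ((b ^ (n * l + 1)) ^ (n ^ i))"
      using u assms(2) by simp
    then have "v (u ^ n) = v (b ^ (n * l + 1))"
      using v_power_cancel[of "u ^ n" "b ^ (n * l + 1)" "n ^ i"] u b n_pow_pos by auto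
    also have "\<dots> = v (b ^ (n * l)) + v b" using v_mult[of b "b ^ (n * l)"] b by (simp add: add.commute)
    \<comment> \<open>Dividing \<open>u\<close> by \<open>b ^ l\<close> removes the multiple n l
      \<gamma> and leaves \<gamma>.\<close>
    finally have "v ((u / b ^ l) ^ n) = v b"
      using u b by (simp add: power_divide v_divide power_mult[symmetric] mult.commute)
    then show False using indivisible[of "u / b ^ l"] u b by auto
  qed
qed

text \<open>The factor \<open>1 + b^(i+1)\<close> is a unit, so it leaves the annulus unchanged while
  making the points for different \<open>i\<close> distinct.\<close>
definition new_point :: "nat \<Rightarrow> nat \<Rightarrow> 'a" where
  "new_point i j = b ^ (n ^ j) + b ^ (n ^ j + Suc i)"

lemma new_point_eq: "new_point i j = b ^ (n ^ j) * (1 + b ^ Suc i)"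
  by (simp add: new_point_def power_add algebra_simps)

lemma new_point_nonzero: "new_point i j \<noteq> 0"
  using one_plus_pos(1)[of "b ^ Suc i"] b v_power_pos[of b "Suc i"] by (simp add: new_point_eq)

lemma v_new_point: "v (new_point i j) = v (b ^ (n ^ j))"
  using one_plus_pos[of "b ^ Suc i"] b v_power_pos[of b "Suc i"]
  by (simp add: new_point_eq v_mult)

text \<open>The value n^j \<gamma> determines \<open>j\<close>; cancelling the common factors leaves
  \<open>b ^ Suc i\<close>, whose value determines \<open>i\<close>.\<close>

lemma new_point_inj:
  assumes "new_point i j = new_point i' j'"
  shows "i = i'"
proof -
  have "n ^ j = n ^ j'" using assms v_new_point b v_power_eq_iff by metis
  then have "b ^ Suc i = b ^ Suc i'" using assms b by (simp add: new_point_eq)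
  then have "Suc i = Suc i'" using b v_power_eq_iff by metis
  then show ?thesis by simp
qed

definition witness :: "nat \<Rightarrow> nat \<Rightarrow> 'a" where
  "witness i j = (if j \<le> i then new_point i j else b ^ (n ^ j + n ^ i))"

lemma witness_nonzero: "witness i j \<noteq> 0"
  using b new_point_nonzero by (simp add: witness_def)

text \<open>Since n^i < n^j for i < j and 2 n^j \<le> n^(j+1), the exponent stays inside the
  annulus. It equals the left endpoint exactly for the added points, which later tells the two kinds
  of witness apart.\<close>

lemma v_witness:
  obtains e where "v (witness i j) = v (b ^ e)" "n ^ j \<le> e" "e < n ^ Suc j"
    "j \<le> i \<Longrightarrow> e = n ^ j" "i < j \<Longrightarrow> n ^ j < e"
proof (cases "j \<le> i")
  case True
  then show thesis using that[of "n ^ j"] v_new_point n_pow_less_iff[of j "Suc j"]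
    by (simp add: witness_def)
next
  case False
  then have "n ^ i < n ^ j" using n_pow_less_iff by simp
  moreover have "2 * n ^ j \<le> n ^ Suc j" using n by simp
  ultimately have "n ^ j + n ^ i < n ^ Suc j" by linarith
  then show thesis using that[of "n ^ j + n ^ i"] False n_pow_pos[of i] by (simp add: witness_def)
qed

lemma witness_annulus_iff:
  "v (b ^ (n ^ j')) \<le> v (witness i j) \<and> v (witness i j) < v (b ^ (n ^ Suc j')) \<longleftrightarrow> j' = j"
proof -
  obtain e where e: "v (witness i j) = v (b ^ e)" "n ^ j \<le> e" "e < n ^ Suc j"
    by (rule v_witness[of i j]) blast
  have "j' = j" if "n ^ j' \<le> e" "e < n ^ Suc j'"
  proof -
    have "n ^ j' < n ^ Suc j" "n ^ j < n ^ Suc j'" using that e(2,3) by linarith+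
    then show ?thesis using n_pow_less_iff by (metis less_Suc_eq_le order_antisym)
  qed
  then show ?thesis using e b by (auto simp: v_power_le_iff v_power_less_iff)
qed

text \<open>The lower bound keeps all added points out of the second disjunct: a value n^j \<gamma>
  that satisfies it has j > i and is divisible by n^(i+1).\<close>

definition in_class :: "nat \<Rightarrow> 'a \<Rightarrow> bool" where
  "in_class i x \<longleftrightarrow> (\<exists>j\<le>i. x = new_point i j) \<or>
     v (b ^ (n ^ Suc i)) \<le> v x \<and> val_mult (n ^ i) x \<and> \<not> val_mult (n ^ Suc i) x"

lemma in_class_witness: "in_class i (witness i j)"
proof (cases "j \<le> i")
  case True
  then show ?thesis by (auto simp: in_class_def witness_def)
next
  case False
  then have w: "witness i j = b ^ (n ^ j + n ^ i)" by (simp add: witness_def)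
  have "n ^ Suc i \<le> n ^ j" using False by (subst n_pow_le_iff) auto
  then have "v (b ^ (n ^ Suc i)) \<le> v (witness i j)" using b by (simp add: w v_power_le_iff)
  moreover have "val_mult (n ^ k) (witness i j) \<longleftrightarrow> k \<le> i" for k
    by (rule val_mult_sum_powers[of _ j]) (use False w in auto)
  ultimately show ?thesis by (simp add: in_class_def del: power_Suc)
qed

text \<open>Either the witness is an added point of class \<open>i'\<close>, and injectivity
  applies, or it satisfies the divisibility condition of class \<open>i'\<close>, which its exponent
  allows only for \<open>i' = i\<close>.\<close>

lemma in_class_witnessD:
  assumes "in_class i' (witness i j)"
  shows "i' = i"
proof -
  obtain e where e: "v (witness i j) = v (b ^ e)" "n ^ j \<le> e" "e < n ^ Suc j"
    "j \<le> i \<Longrightarrow> e = n ^ j" "i < j \<Longrightarrow> n ^ j < e"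
    by (rule v_witness[of i j]) blast
  consider (point) j' where "witness i j = new_point i' j'"
    | (val) "v (b ^ (n ^ Suc i')) \<le> v (witness i j)" "val_mult (n ^ i') (witness i j)"
        "\<not> val_mult (n ^ Suc i') (witness i j)"
    using assms by (auto simp: in_class_def)
  then show ?thesis
  proof cases
    case point
    then have ej: "e = n ^ j'" using e(1) b by (simp add: v_new_point v_power_eq_iff)
    have "j \<le> i"
    proof (rule ccontr)
      assume "\<not> j \<le> i"
      \<comment> \<open>Otherwise the exponent would be a power of n strictly between two
        consecutive ones.\<close>
      then have "n ^ j < n ^ j'" "n ^ j' < n ^ Suc j" using e ej by auto
      then show False unfolding n_pow_less_iff by simp
    qed
    then show ?thesis using point new_point_inj[of i' j' i j] by (simp add: witness_def)
  next
    case val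
    then have "n ^ Suc i' \<le> e" using e(1) b by (simp add: v_power_le_iff)
    then have "n ^ Suc i' < n ^ Suc j" using e by linarith
    then have ij: "Suc i' \<le> j" unfolding n_pow_less_iff by simp
    show ?thesis
    proof (cases "j \<le> i")
      case True
      \<comment> \<open>Here the exponent is n^j with j \<ge> i' + 1, so the value is divisible by
        n^(i'+1), against the class condition.\<close>
      have "v ((b ^ (n ^ (j - Suc i'))) ^ (n ^ Suc i')) = v (witness i j)"
        using e(1) e(4)[OF True] ij by (simp add: power_mult[symmetric] power_add[symmetric] del: power_Suc)
      then have "val_mult (n ^ Suc i') (witness i j)"
        unfolding val_mult_def using b by (intro exI[of _ "b ^ (n ^ (j - Suc i'))"]) auto
      then show ?thesis using val by simp
    next
      case False
      then have "val_mult (n ^ k) (witness i j) \<longleftrightarrow> k \<le> i" for k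
        by (intro val_mult_sum_powers[of _ j]) (auto simp: witness_def)
      then show ?thesis using val(2) val(3) by (metis not_less_eq_eq order_antisym)
    qed
  qed
qed

section \<open>Definability of the classes, and the pattern in the field\<close>

lemma sat_val_mult_fm:
  assumes "e 0 \<noteq> 0" "0 < m"
  shows "sat (VF v) e (val_mult_fm m) \<longleftrightarrow> val_mult m (e 0)"
proof -
  have "sat (VF v) e (val_mult_fm m) \<longleftrightarrow>
      (\<exists>u. u ^ m \<noteq> 0 \<and> v (u ^ m) \<le> v (e 0) \<and> v (e 0) \<le> v (u ^ m))"
    using assms by (auto simp: val_mult_fm_def tval_pow_tm) (auto simp: VF_def)
  also have "\<dots> \<longleftrightarrow> val_mult m (e 0)"
    using assms(2) by (auto simp: val_mult_def)
  finally show ?thesis .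
qed

text \<open>The number of disjuncts grows with \<open>i\<close>, which is allowed since the first
  family may use a different formula for each index. The fold starts from a contradiction as the
  empty disjunction.\<close>

definition class_fm :: "nat \<Rightarrow> fm" where
  "class_fm i = disj_fm
     (foldr (\<lambda>j. disj_fm (Eq (Var 0) (Plus (pow_tm (Var 1) (n ^ j)) (pow_tm (Var 1) (n ^ j + Suc i)))))
       [0..<Suc i] (Neg (Eq (Var 0) (Var 0))))
     (Conj (Dv (pow_tm (Var 1) (n ^ Suc i)) (Var 0))
       (Conj (val_mult_fm (n ^ i)) (Neg (val_mult_fm (n ^ Suc i)))))"

lemma sat_class_fm:
  assumes "e 0 \<noteq> 0" "e 1 = b"
  shows "sat (VF v) e (class_fm i) \<longleftrightarrow> in_class i (e 0)"
proof -
  have pt: "sat (VF v) e (Eq (Var 0) (Plus (pow_tm (Var 1) (n ^ j)) (pow_tm (Var 1) (n ^ j + Suc i))))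
      \<longleftrightarrow> e 0 = new_point i j" for j
  proof -
    have "plusf (VF v) = (+)" by (simp add: VF_def)
    then show ?thesis using n_pow_pos[of j] assms by (simp add: tval_pow_tm new_point_def del: power_Suc)
  qed
  have "sat (VF v) e (foldr (\<lambda>j. disj_fm (Eq (Var 0)
        (Plus (pow_tm (Var 1) (n ^ j)) (pow_tm (Var 1) (n ^ j + Suc i))))) js (Neg (Eq (Var 0) (Var 0))))
      \<longleftrightarrow> (\<exists>j \<in> set js. e 0 = new_point i j)" for js
    unfolding sat_foldr_disj_fm pt by simp
  moreover have "sat (VF v) e (Dv (pow_tm (Var 1) (n ^ Suc i)) (Var 0)) \<longleftrightarrow> v (b ^ (n ^ Suc i)) \<le> v (e 0)"
    using assms b n_pow_pos[of "Suc i"] by (simp add: tval_pow_tm del: power_Suc) (simp add: VF_def)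
  moreover have "sat (VF v) e (val_mult_fm (n ^ k)) \<longleftrightarrow> val_mult (n ^ k) (e 0)" for k
    by (rule sat_val_mult_fm) (rule assms(1), rule n_pow_pos)
  ultimately show ?thesis
    unfolding class_fm_def in_class_def sat_disj_fm sat.simps(3,4)
    by (simp add: Bex_def less_Suc_eq_le del: power_Suc upt_Suc)
qed

text \<open>The point \<open>witness i0 j0\<close> lies in its own class and annulus and in no
  other, so it serves for all finite \<open>I\<close> and \<open>J\<close> at once.\<close>

lemma has_dp_pattern_VF: "has_dp_pattern (VF v)"
proof -
  let ?p = "\<lambda>i::nat. \<lambda>k::nat. b"
  let ?b = "\<lambda>j::nat. \<lambda>k::nat. if k = 1 then b ^ (n ^ j) else b ^ (n ^ Suc j)"
  have univ: "univ (VF v) = UNIV" by (simp add: VF_def)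
  have ann: "sat (VF v) ((?b j')(0 := witness i j)) annulus_fm \<longleftrightarrow> j' = j" for i j j'
    using witness_annulus_iff[of j' i j] witness_nonzero[of i j] b
    by (auto simp: annulus_fm_def VF_def not_le)
  have cl: "sat (VF v) ((?p i')(0 := witness i j)) (class_fm i') \<longleftrightarrow> i' = i" for i j i'
    using sat_class_fm[of "(?p i')(0 := witness i j)" i'] witness_nonzero[of i j]
      in_class_witness in_class_witnessD by auto
  show ?thesis
    unfolding has_dp_pattern_def univ
    by (intro exI[of _ class_fm] exI[of _ ?p] exI[of _ annulus_fm] exI[of _ ?b] conjI allI impI
          bexI[of _ "witness _ _"]) (auto simp only: ann cl subset_UNIV DiffE singleton_iff)
qed

end

lemma is_structure_VF: "is_structure (VF v)"
  by (simp add: is_structure_def VF_def)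

theorem theorem1p6:
  fixes v :: "'a::field \<Rightarrow> 'g::linordered_ab_group_add"
  assumes "valuation v"
      and "henselian v"
      and "dp_small (VF v)"
  shows "\<forall>(g::'g) (n::nat). 0 < n \<longrightarrow> (\<exists>h::'g. (\<Sum>i<n. h) = g)"
proof (intro allI impI)
  fix g :: 'g and n :: nat
  assume n: "0 < n"
  interpret valued_field v by (standard) (rule assms(1))
  have pos: "\<exists>h::'g. (\<Sum>i<n. h) = g" if "0 < g" for g
  proof (rule ccontr)
    assume no: "\<nexists>h::'g. (\<Sum>i<n. h) = g"
    obtain b where b: "b \<noteq> 0" "v b = g" using assms(1) unfolding valuation_def by blast
    \<comment> \<open>For n = 1 the choice h = g would do; this gives the bound 2 \<le> n of the
      locale.\<close>
    have "n \<noteq> 1" using no by auto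
    then have "indivisible v b n"
      using n b that no by unfold_locales (auto simp: v_power)
    then show False
      using indivisible.has_dp_pattern_VF has_dp_pattern_imp_not_dp_small[OF is_structure_VF] assms(3)
      by blast
  qed
  consider "0 < g" | "g = 0" | "0 < - g" by (metis neg_0_less_iff_less linorder_less_linear)
  then show "\<exists>h::'g. (\<Sum>i<n. h) = g"
  proof cases
    case 1
    then show ?thesis by (rule pos)
  next
    case 2
    then show ?thesis by (intro exI[of _ 0]) simp
  next
    case 3
    then obtain h where "(\<Sum>i<n. h) = - g" using pos by blast
    then have "(\<Sum>i<n. - h) = g" by (simp add: sum_negf)
    then show ?thesis by blast
  qed
qed

end
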